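(* For all $n\ge1$ and all $k$, $R_{k,2n+1}=P_{0,k,2n+1}+P_{1,k,2n+1}$; equivalently $R_{2n+1}(x)=P_{2n+1}(x,1)$.
   Context: $\mathcal{S}_m$ denotes the set of permutations $\sigma=\sigma_1\cdots\sigma_m$ of $\{1,\dots,m\}$. $\overleftarrow{des}_E(\sigma)$ is the number of indices $i$ with $\sigma_i>\sigma_{i+1}$ and $\sigma_i$ even; $\overrightarrow{des}_E(\sigma)$ is the number of indices $i$ with $\sigma_i>\sigma_{i+1}$ and $\sigma_{i+1}$ even. $R_m(x)=\sum_{\sigma\in\mathcal{S}_m}x^{\overleftarrow{des}_E(\sigma)}=\sum_k R_{k,m}x^k$ and $P_m(x,z)=\sum_{\sigma\in\mathcal{S}_m}x^{\overrightarrow{des}_E(\sigma)}z^{\chi(\sigma_1\text{ even})}=\sum_{j\in\{0,1\}}\sum_k P_{j,k,m}z^jx^k$, where $\chi(\sigma_1\text{ even})$ is $1$ if $\sigma_1$ is even and $0$ otherwise. *)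

theory Defs
  imports "HOL-Combinatorics.Multiset_Permutations" "HOL-Computational_Algebra.Polynomial"
begin

text \<open>A permutation \<open>\<sigma>\<^sub>1\<dots>\<sigma>\<^sub>m\<close> is represented by its one-line word, a list with
  \<open>\<sigma> ! i\<close> standing for \<open>\<sigma>\<^sub>i\<^sub>+\<^sub>1\<close>.\<close>

abbreviation Sym :: "nat \<Rightarrow> nat list set" where
  "Sym m \<equiv> permutations_of_set {1..m}"

definition desE_left :: "nat list \<Rightarrow> nat" where
  "desE_left \<sigma> = card {i. Suc i < length \<sigma> \<and> \<sigma> ! i > \<sigma> ! Suc i \<and> even (\<sigma> ! i)}"

definition desE_right :: "nat list \<Rightarrow> nat" where
  "desE_right \<sigma> = card {i. Suc i < length \<sigma> \<and> \<sigma> ! i > \<sigma> ! Suc i \<and> even (\<sigma> ! Suc i)}"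

definition chi_first_even :: "nat list \<Rightarrow> nat" where
  "chi_first_even \<sigma> = (if even (\<sigma> ! 0) then 1 else 0)"

definition R :: "nat \<Rightarrow> int poly" where
  "R m = (\<Sum>\<sigma>\<in>Sym m. monom 1 (desE_left \<sigma>))"

text \<open>\<open>P m\<close> is a polynomial in \<open>z\<close> whose coefficients are polynomials in \<open>x\<close>: the outer
  exponent is that of \<open>z\<close>, and \<open>poly (P m) 1\<close> is \<open>P\<^sub>m(x,1)\<close>.\<close>

definition P :: "nat \<Rightarrow> int poly poly" where
  "P m = (\<Sum>\<sigma>\<in>Sym m. monom (monom 1 (desE_right \<sigma>)) (chi_first_even \<sigma>))"

definition R_coeff :: "nat \<Rightarrow> nat \<Rightarrow> int" where
  "R_coeff k m = coeff (R m) k"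

definition P_coeff :: "nat \<Rightarrow> nat \<Rightarrow> nat \<Rightarrow> int" where
  "P_coeff j k m = coeff (coeff (P m) j) k"

end

theory Submission
  imports Defs
begin

text \<open>The reverse-complement \<open>\<sigma>\<^sub>i \<mapsto> m + 1 - \<sigma>\<^bsub>m+1-i\<^esub>\<close> of a permutation keeps descents and swaps the
  roles of descent tops and descent bottoms. For odd \<open>m\<close> the complement \<open>a \<mapsto> m + 1 - a\<close> preserves
  parity, so it carries the left statistic to the right one.\<close>

definition rev_compl :: "nat \<Rightarrow> nat list \<Rightarrow> nat list" where
  "rev_compl m \<sigma> = rev (map (\<lambda>a. Suc m - a) \<sigma>)"

lemma length_rev_compl [simp]: "length (rev_compl m \<sigma>) = length \<sigma>"
  by (simp add: rev_compl_def)

lemma rev_compl_nth: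
  assumes "i < length \<sigma>"
  shows "rev_compl m \<sigma> ! i = Suc m - \<sigma> ! (length \<sigma> - Suc i)"
  using assms by (simp add: rev_compl_def rev_nth)

lemma rev_compl_in_Sym:
  assumes "\<sigma> \<in> Sym m"
  shows "rev_compl m \<sigma> \<in> Sym m"
proof -
  have set: "set \<sigma> = {1..m}" and dist: "distinct \<sigma>"
    using assms by (auto simp: permutations_of_set_def)
  have "(\<lambda>a. Suc m - a) ` {1..m} = {1..m}"
  proof (intro equalityI subsetI)
    fix b assume "b \<in> {1..m}"
    \<comment> \<open>The complement is an involution on \<open>{1..m}\<close>, so
      \<open>Suc m - b\<close> is the preimage of \<open>b\<close>.\<close>
    then have "b = Suc m - (Suc m - b)" "Suc m - b \<in> {1..m}" by auto
    then show "b \<in> (\<lambda>a. Suc m - a) ` {1..m}" by blast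
  qed auto
  moreover have "inj_on (\<lambda>a. Suc m - a) {1..m}"
    by (auto simp: inj_on_def)
  ultimately show ?thesis
    using set dist by (simp add: permutations_of_set_def rev_compl_def distinct_map)
qed

lemma rev_compl_involution:
  assumes "\<sigma> \<in> Sym m"
  shows "rev_compl m (rev_compl m \<sigma>) = \<sigma>"
proof -
  have "Suc m - (Suc m - a) = a" if "a \<in> set \<sigma>" for a
    using that assms by (auto simp: permutations_of_set_def)
  then show ?thesis
    by (simp add: rev_compl_def rev_map map_idI)
qed

lemma bij_betw_rev_compl: "bij_betw (rev_compl m) (Sym m) (Sym m)"
  by (rule bij_betw_byWitness[where f' = "rev_compl m"])
    (use rev_compl_involution rev_compl_in_Sym in blast)+

lemma desE_right_rev_compl:
  assumes "odd m" and "\<sigma> \<in> Sym m"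
  shows "desE_right (rev_compl m \<sigma>) = desE_left \<sigma>"
proof -
  let ?\<tau> = "rev_compl m \<sigma>" and ?l = "length \<sigma>"
  \<comment> \<open>Subtraction on \<open>nat\<close> truncates, so
    \<open>a \<mapsto> Suc m - a\<close> is sure to reverse order strictly only on entries bounded
    in this way.\<close>
  have bound: "\<sigma> ! i \<le> m" if "i < ?l" for i
    using that assms(2) nth_mem[OF that] by (auto simp: permutations_of_set_def)
  define A where "A = {i. Suc i < ?l \<and> \<sigma> ! i > \<sigma> ! Suc i \<and> even (\<sigma> ! i)}"
  define B where "B = {i. Suc i < ?l \<and> ?\<tau> ! i > ?\<tau> ! Suc i \<and> even (?\<tau> ! Suc i)}"
  have step: "i \<in> B \<longleftrightarrow> ?l - 2 - i \<in> A" if "Suc i < ?l" for i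
  proof -
    \<comment> \<open>Reversal sends the adjacent positions \<open>i\<close>, \<open>Suc i\<close>
      to \<open>Suc j\<close>, \<open>j\<close>. This flips the pair and the complement flips the
      order again, so descents persist, and the bottom at \<open>Suc i\<close> is the complement of
      the top \<open>\<sigma> ! j\<close>.\<close>
    define j where "j = ?l - 2 - i"
    have j: "Suc j < ?l" "?l - Suc i = Suc j" "?l - Suc (Suc i) = j"
      using that by (auto simp: j_def)
    have "?\<tau> ! i = Suc m - \<sigma> ! Suc j" "?\<tau> ! Suc i = Suc m - \<sigma> ! j"
      using that j by (simp_all add: rev_compl_nth)
    moreover have "\<sigma> ! j \<le> m" "\<sigma> ! Suc j \<le> m"
      using bound j by auto
    moreover from this have "Suc m - \<sigma> ! Suc j > Suc m - \<sigma> ! j \<longleftrightarrow> \<sigma> ! j > \<sigma> ! Suc j"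
      by linarith
    \<comment> \<open>Here oddness of \<open>m\<close> enters: \<open>Suc m\<close> is even, so
      subtracting from it keeps parity.\<close>
    moreover from \<open>\<sigma> ! j \<le> m\<close> have "even (Suc m - \<sigma> ! j) \<longleftrightarrow> even (\<sigma> ! j)"
      using assms(1) by (simp add: even_diff_nat)
    ultimately have "i \<in> B \<longleftrightarrow> j \<in> A"
      using that j(1) by (simp add: A_def B_def)
    then show ?thesis by (simp only: j_def)
  qed
  have "bij_betw (\<lambda>i. ?l - 2 - i) B A"
  proof (rule bij_betw_byWitness[where f' = "\<lambda>i. ?l - 2 - i"])
    show "(\<lambda>i. ?l - 2 - i) ` B \<subseteq> A"
      using step by (auto simp: B_def)
    show "(\<lambda>i. ?l - 2 - i) ` A \<subseteq> B"
    proof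
      \<comment> \<open>Reflecting \<open>k\<close> gives back \<open>i\<close>, so
        \<open>step\<close> at \<open>k\<close> yields this inclusion as well.\<close>
      fix k assume "k \<in> (\<lambda>i. ?l - 2 - i) ` A"
      then obtain i where i: "i \<in> A" "k = ?l - 2 - i" by blast
      then have "Suc i < ?l" by (simp add: A_def)
      with i have "Suc k < ?l" "?l - 2 - k = i" by auto
      with step[of k] i show "k \<in> B" by simp
    qed
  qed (auto simp: A_def B_def)
  then have "card B = card A"
    by (rule bij_betw_same_card)
  then show ?thesis
    by (simp add: desE_left_def desE_right_def A_def B_def)
qed

lemma poly_P_1: "poly (P m) 1 = (\<Sum>\<sigma>\<in>Sym m. monom 1 (desE_right \<sigma>))"
  by (simp add: P_def poly_sum poly_monom)

text \<open>Since \<open>chi_first_even\<close> is 0 or 1, each permutation contributes its monomial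
  in \<open>x\<close> to exactly one of the two coefficients in \<open>z\<close>.\<close>

lemma P_coeff_0_plus_1: "P_coeff 0 k m + P_coeff 1 k m = coeff (poly (P m) 1) k"
proof -
  have "coeff (P m) 0 + coeff (P m) 1 = poly (P m) 1"
    unfolding poly_P_1 unfolding P_def coeff_sum sum.distrib[symmetric]
    by (rule sum.cong) (auto simp: chi_first_even_def)
  then show ?thesis
    by (simp add: P_coeff_def flip: coeff_add)
qed

lemma R_eq_poly_P_1:
  assumes "odd m"
  shows "R m = poly (P m) 1"
proof -
  have "R m = (\<Sum>\<sigma>\<in>Sym m. monom 1 (desE_right (rev_compl m \<sigma>)))"
    unfolding R_def by (rule sum.cong) (simp_all add: desE_right_rev_compl assms)
  also have "\<dots> = poly (P m) 1"
    unfolding poly_P_1 by (rule sum.reindex_bij_betw[OF bij_betw_rev_compl])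
  finally show ?thesis .
qed

theorem theorem4p5:
  fixes n :: nat
  assumes "n \<ge> 1"
  shows "(\<forall>k. R_coeff k (2 * n + 1) = P_coeff 0 k (2 * n + 1) + P_coeff 1 k (2 * n + 1))
    \<and> R (2 * n + 1) = poly (P (2 * n + 1)) 1"
proof -
  have "R (2 * n + 1) = poly (P (2 * n + 1)) 1"
    by (rule R_eq_poly_P_1) simp
  then show ?thesis
    \<comment> \<open>Both conjuncts reduce to the same polynomial identity, the first by comparing
      coefficients.\<close>
    by (simp only: P_coeff_0_plus_1 R_coeff_def) simp
qed

end
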